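(* Let an instance of the zone tariff design problem with upper bound $N\in\mathbb{N}_{\ge1}$ on the number of zones be given. The following holds with/without requiring the no-elongation property and with/without requiring the no-stopover property (the same choice being made for both problem variants). For every solution $\mathcal{Z},P$ to ZD-MA with upper bound $N$ on the number of zones, there is an $N'\in\mathbb{N}$ with $N'\le\vert V\vert$ and a zone partition $\mathcal{Z}'$ such that $\mathcal{Z}',P$ is feasible to ZD-MC with upper bound $N'$ on the number of zones (and otherwise the same instance data) with the same objective function value. In particular, if $N=\vert V\vert$, we have $z^{\ast}_{\mathrm{MA}}=z^{\ast}_{\mathrm{MC}}$, where $z^{\ast}_{\mathrm{MA}}$ and $z^{\ast}_{\mathrm{MC}}$ are the optimal objective function values of ZD-MA and ZD-MC on the given instance.
   Context: A public transport network (PTN) $G=(V,E)$ is a finite undirected, connected, simple graph. A path is a finite sequence $(v_1,e_1,v_2,\ldots,e_{n-1},v_n)$ of nodes and edges (repetitions allowed), also written as its node sequence $(v_1,\ldots,v_n)$; $\mathcal{W}$ is the set of all paths, $V(W)$ and $E(W)$ are the set of nodes and the set of edges of $W\in\mathcal{W}$. A fare structure is a function $\pi\colon\mathcal{W}\to\mathbb{R}_{\ge0}$. A zone partition $\mathcal{Z}$ is a partition of $V$ into pairwise disjoint zones with union $V$. For multiple counting, the zone function is $\sigma(W)=1+\sum_{e\in E(W)}b(e)$ for paths $W$, where $b(\{v_1,v_2\})=0$ if $v_1,v_2$ are in the same zone and $1$ otherwise. The zone tariff with multiple counting w.r.t. $\mathcal{Z}$ and a price function $P\colon\mathbb{N}_{\ge1}\to\mathbb{R}_{\ge0}$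 is the fare structure $\pi(W)=P(\sigma(W))$. A fare structure $\pi$ satisfies the no-elongation property if $\pi((v_1,\ldots,v_{n-1}))\le\pi((v_1,\ldots,v_n))$ for all paths $(v_1,\ldots,v_n)\in\mathcal{W}$, $n\ge2$. It satisfies the no-stopover property if $\pi((v_1,\ldots,v_n))\le\pi((v_1,\ldots,v_i))+\pi((v_i,\ldots,v_n))$ for all paths $(v_1,\ldots,v_n)\in\mathcal{W}$, $n\ge3$, and all $i\in\{2,\ldots,n-1\}$. Zone tariff design problem: given a PTN $(V,E)$, a set $D\subseteq (V\times V)\setminus\{(v,v):v\in V\}$ of OD pairs, reference prices $r_d\in\mathbb{R}_{\ge0}$, passenger numbers $t_d\in\mathbb{N}_{\ge1}$ and paths $W_d\in\mathcal{W}$ for all $d\in D$, and an upper bound $N\in\mathbb{N}_{\ge1}$ on the number of zones, determine a zone partition $\mathcal{Z}$ with at most $N$ zones and a price function $P$ such that $\sum_{d\in D}t_d\vert r_d-P(\sigma(W_d))\vert$ is minimized. ZD-MA is the variant with multiple counting and arbitrary zones (no further requirement); ZD-MC is the variant with multiple counting and connected zones, i.e., the induced subgraph $G[Z]$ must be connected for each $Z\in\mathcal{Z}$. "Requiring" a property means that the resulting zone tariff has to satisfy it. A "solution" means a feasible pair $\mathcal{Z},P$. *)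

theory Defs
  imports "HOL-Analysis.Analysis" "HOL-Library.Disjoint_Sets"
begin

section \<open>Public transport networks and paths\<close>

text \<open>
  An undirected edge is the two-element set of its endpoints. As the graph is simple, a path
  is determined by its non-empty node sequence; nodes and edges may be repeated.
\<close>

definition ptn_path :: "'a set \<Rightarrow> 'a set set \<Rightarrow> 'a list \<Rightarrow> bool" where
  "ptn_path V E W \<longleftrightarrow> W \<noteq> [] \<and> set W \<subseteq> V \<and> successively (\<lambda>u v. {u, v} \<in> E) W"

definition path_edges :: "'a list \<Rightarrow> 'a set set" where
  "path_edges W = {{W ! i, W ! Suc i} |i. Suc i < length W}"

definition simple_graph :: "'a set \<Rightarrow> 'a set set \<Rightarrow> bool" where
  "simple_graph V E \<longleftrightarrow> finite V \<and> (\<forall>e\<in>E. \<exists>u\<in>V. \<exists>v\<in>V. u \<noteq> v \<and> e = {u, v})"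

definition connected_graph :: "'a set \<Rightarrow> 'a set set \<Rightarrow> bool" where
  "connected_graph V E \<longleftrightarrow>
     V \<noteq> {} \<and> (\<forall>u\<in>V. \<forall>v\<in>V. \<exists>W. ptn_path V E W \<and> hd W = u \<and> last W = v)"

definition induced_edges :: "'a set set \<Rightarrow> 'a set \<Rightarrow> 'a set set" where
  "induced_edges E S = {e \<in> E. e \<subseteq> S}"

definition ptn :: "'a set \<Rightarrow> 'a set set \<Rightarrow> bool" where
  "ptn V E \<longleftrightarrow> simple_graph V E \<and> connected_graph V E"

section \<open>Zone tariffs with multiple counting\<close>

text \<open>
  Zone partitions of \<open>V\<close> are rendered by \<^const>\<open>partition_on\<close>; in particular zones are non-empty.
\<close>

definition border :: "'a set set \<Rightarrow> 'a set \<Rightarrow> nat" where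
  "border Z e = (if \<exists>z\<in>Z. e \<subseteq> z then 0 else 1)"

text \<open>
  The sum ranges over the \<^emph>\<open>set\<close> of edges of the path: a border edge that is traversed several
  times contributes once.
\<close>

definition zone_count :: "'a set set \<Rightarrow> 'a list \<Rightarrow> nat" where
  "zone_count Z W = 1 + (\<Sum>e\<in>path_edges W. border Z e)"

text \<open>
  Price functions live on the positive integers; \<^const>\<open>zone_count\<close> is always positive,
  so the value at \<open>0\<close> is irrelevant and is left unconstrained.
\<close>

definition price_function :: "(nat \<Rightarrow> real) \<Rightarrow> bool" where
  "price_function P \<longleftrightarrow> (\<forall>k\<ge>1. 0 \<le> P k)"

definition zone_tariff :: "'a set set \<Rightarrow> (nat \<Rightarrow> real) \<Rightarrow> 'a list \<Rightarrow> real" where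
  "zone_tariff Z P W = P (zone_count Z W)"

definition no_elongation :: "'a set \<Rightarrow> 'a set set \<Rightarrow> ('a list \<Rightarrow> real) \<Rightarrow> bool" where
  "no_elongation V E \<pi> \<longleftrightarrow>
     (\<forall>W. ptn_path V E W \<and> 2 \<le> length W \<longrightarrow> \<pi> (butlast W) \<le> \<pi> W)"

text \<open>
  With nodes numbered from 1, \<open>take i W\<close> is \<open>(v\<^sub>1, \<dots>, v\<^sub>i)\<close> and \<open>drop (i - 1) W\<close> is
  \<open>(v\<^sub>i, \<dots>, v\<^sub>n)\<close>.
\<close>

definition no_stopover :: "'a set \<Rightarrow> 'a set set \<Rightarrow> ('a list \<Rightarrow> real) \<Rightarrow> bool" where
  "no_stopover V E \<pi> \<longleftrightarrow>
     (\<forall>W. ptn_path V E W \<and> 3 \<le> length W \<longrightarrow>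
        (\<forall>i\<in>{2..length W - 1}. \<pi> W \<le> \<pi> (take i W) + \<pi> (drop (i - 1) W)))"

section \<open>The zone tariff design problem\<close>

definition zd_instance ::
  "'a set \<Rightarrow> 'a set set \<Rightarrow> ('a \<times> 'a) set \<Rightarrow> ('a \<times> 'a \<Rightarrow> real) \<Rightarrow> ('a \<times> 'a \<Rightarrow> nat) \<Rightarrow>
   ('a \<times> 'a \<Rightarrow> 'a list) \<Rightarrow> nat \<Rightarrow> bool" where
  "zd_instance V E D r t W N \<longleftrightarrow>
     ptn V E \<and> D \<subseteq> V \<times> V - {(v, v) |v. v \<in> V} \<and>
     (\<forall>d\<in>D. 0 \<le> r d \<and> 1 \<le> t d \<and> ptn_path V E (W d)) \<and> 1 \<le> N"

definition zd_objective ::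
  "('a \<times> 'a) set \<Rightarrow> ('a \<times> 'a \<Rightarrow> real) \<Rightarrow> ('a \<times> 'a \<Rightarrow> nat) \<Rightarrow> ('a \<times> 'a \<Rightarrow> 'a list) \<Rightarrow>
   'a set set \<Rightarrow> (nat \<Rightarrow> real) \<Rightarrow> real" where
  "zd_objective D r t W Z P = (\<Sum>d\<in>D. real (t d) * \<bar>r d - zone_tariff Z P (W d)\<bar>)"

text \<open>
  The Boolean arguments \<open>ne\<close> and \<open>ns\<close> say whether the no-elongation property and the no-stopover
  property are required.
\<close>

definition zd_ma_feasible ::
  "'a set \<Rightarrow> 'a set set \<Rightarrow> bool \<Rightarrow> bool \<Rightarrow> nat \<Rightarrow> 'a set set \<Rightarrow> (nat \<Rightarrow> real) \<Rightarrow> bool" where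
  "zd_ma_feasible V E ne ns N Z P \<longleftrightarrow>
     partition_on V Z \<and> card Z \<le> N \<and> price_function P \<and>
     (ne \<longrightarrow> no_elongation V E (zone_tariff Z P)) \<and>
     (ns \<longrightarrow> no_stopover V E (zone_tariff Z P))"

definition zd_mc_feasible ::
  "'a set \<Rightarrow> 'a set set \<Rightarrow> bool \<Rightarrow> bool \<Rightarrow> nat \<Rightarrow> 'a set set \<Rightarrow> (nat \<Rightarrow> real) \<Rightarrow> bool" where
  "zd_mc_feasible V E ne ns N Z P \<longleftrightarrow>
     zd_ma_feasible V E ne ns N Z P \<and> (\<forall>z\<in>Z. connected_graph z (induced_edges E z))"

text \<open>
  Optimal objective function values, as infima over the feasible pairs. The lemmas
  \<open>zd_ma_opt_attained\<close> and \<open>zd_mc_opt_attained\<close> below show that for every instance these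
  infima are minima.
\<close>

definition zd_ma_opt ::
  "'a set \<Rightarrow> 'a set set \<Rightarrow> ('a \<times> 'a) set \<Rightarrow> ('a \<times> 'a \<Rightarrow> real) \<Rightarrow> ('a \<times> 'a \<Rightarrow> nat) \<Rightarrow>
   ('a \<times> 'a \<Rightarrow> 'a list) \<Rightarrow> bool \<Rightarrow> bool \<Rightarrow> nat \<Rightarrow> real" where
  "zd_ma_opt V E D r t W ne ns N =
     Inf {zd_objective D r t W Z P |Z P. zd_ma_feasible V E ne ns N Z P}"

definition zd_mc_opt ::
  "'a set \<Rightarrow> 'a set set \<Rightarrow> ('a \<times> 'a) set \<Rightarrow> ('a \<times> 'a \<Rightarrow> real) \<Rightarrow> ('a \<times> 'a \<Rightarrow> nat) \<Rightarrow>
   ('a \<times> 'a \<Rightarrow> 'a list) \<Rightarrow> bool \<Rightarrow> bool \<Rightarrow> nat \<Rightarrow> real" where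
  "zd_mc_opt V E D r t W ne ns N =
     Inf {zd_objective D r t W Z P |Z P. zd_mc_feasible V E ne ns N Z P}"

subsection \<open>The optimal values are attained\<close>

lemma continuous_on_zone_tariff: "continuous_on S (\<lambda>P. zone_tariff Z P W)"
  unfolding zone_tariff_def
  by (rule continuous_on_subset[OF continuous_on_product_coordinates]) simp

lemma closed_no_elongation: "closed {P. no_elongation V E (zone_tariff Z P)}"
proof -
  have "{P. no_elongation V E (zone_tariff Z P)} =
    (\<Inter>W\<in>{W. ptn_path V E W \<and> 2 \<le> length W}.
       {P. zone_tariff Z P (butlast W) \<le> zone_tariff Z P W})"
    by (auto simp: no_elongation_def)
  then show ?thesis
    by (auto intro!: closed_INT closed_Collect_le continuous_on_zone_tariff)
qed

lemma closed_no_stopover: "closed {P. no_stopover V E (zone_tariff Z P)}"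
proof -
  have "{P. no_stopover V E (zone_tariff Z P)} =
    (\<Inter>W\<in>{W. ptn_path V E W \<and> 3 \<le> length W}. \<Inter>i\<in>{2..length W - 1}.
       {P. zone_tariff Z P W \<le> zone_tariff Z P (take i W) + zone_tariff Z P (drop (i - 1) W)})"
    by (auto simp: no_stopover_def)
  then show ?thesis
    by (auto intro!: closed_INT closed_Collect_le continuous_on_zone_tariff continuous_on_add)
qed

lemma continuous_on_zd_objective: "continuous_on S (zd_objective D r t W Z)"
  unfolding zd_objective_def
  by (intro continuous_intros continuous_on_zone_tariff)

lemma compact_box: "compact {P :: nat \<Rightarrow> real. \<forall>k. P k \<in> {0..M}}"
proof -
  have "compactin (product_topology (\<lambda>i::nat. euclidean :: real topology) UNIV)
          (PiE UNIV (\<lambda>_. {0..M}))"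
    by (subst compactin_PiE) simp
  moreover have "PiE UNIV (\<lambda>_. {0..M}) = {P :: nat \<Rightarrow> real. \<forall>k. P k \<in> {0..M}}"
    by (auto simp: PiE_def Pi_def)
  ultimately show ?thesis
    by (simp add: euclidean_product_topology)
qed

text \<open>
  Cutting prices off at an upper bound of the reference prices keeps a solution feasible and does
  not increase its objective function value.
\<close>

definition cut_price :: "real \<Rightarrow> (nat \<Rightarrow> real) \<Rightarrow> nat \<Rightarrow> real" where
  "cut_price M P k = max 0 (min (P k) M)"

lemma zone_tariff_nonneg: "price_function P \<Longrightarrow> 0 \<le> zone_tariff Z P W"
  by (simp add: price_function_def zone_tariff_def zone_count_def)

lemma zone_tariff_cut_price:
  "price_function P \<Longrightarrow> 0 \<le> M \<Longrightarrow> zone_tariff Z (cut_price M P) W = min (zone_tariff Z P W) M"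
  using zone_tariff_nonneg[of P Z W] by (simp add: zone_tariff_def cut_price_def)

lemma zd_ma_feasible_cut_price:
  assumes "zd_ma_feasible V E ne ns N Z P" "0 \<le> M"
  shows "zd_ma_feasible V E ne ns N Z (cut_price M P)"
proof -
  from assms have P: "price_function P" by (simp add: zd_ma_feasible_def)
  have c: "zone_tariff Z (cut_price M P) W = min (zone_tariff Z P W) M" for W
    by (rule zone_tariff_cut_price[OF P assms(2)])
  have "no_elongation V E (zone_tariff Z (cut_price M P))"
    if "no_elongation V E (zone_tariff Z P)"
    using that unfolding no_elongation_def c by (meson min.mono order_refl)
  moreover have "no_stopover V E (zone_tariff Z (cut_price M P))"
    if *: "no_stopover V E (zone_tariff Z P)"
    unfolding no_stopover_def
  proof (intro allI impI ballI)
    fix W i assume W: "ptn_path V E W \<and> 3 \<le> length W" and i: "i \<in> {2..length W - 1}"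
    have "zone_tariff Z P W \<le> zone_tariff Z P (take i W) + zone_tariff Z P (drop (i - 1) W)"
      using * W i unfolding no_stopover_def by blast
    then show "zone_tariff Z (cut_price M P) W \<le>
        zone_tariff Z (cut_price M P) (take i W) + zone_tariff Z (cut_price M P) (drop (i - 1) W)"
      using zone_tariff_nonneg[OF P, of Z "take i W"]
        zone_tariff_nonneg[OF P, of Z "drop (i - 1) W"] assms(2)
      unfolding c by linarith
  qed
  moreover have "price_function (cut_price M P)"
    by (simp add: price_function_def cut_price_def)
  ultimately show ?thesis
    using assms(1) by (auto simp: zd_ma_feasible_def)
qed

lemma zd_objective_cut_price:
  assumes "price_function P" "0 \<le> M" "\<forall>d\<in>D. r d \<le> M"
  shows "zd_objective D r t W Z (cut_price M P) \<le> zd_objective D r t W Z P"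
  unfolding zd_objective_def
proof (rule sum_mono)
  fix d assume "d \<in> D"
  then have "\<bar>r d - min (zone_tariff Z P (W d)) M\<bar> \<le> \<bar>r d - zone_tariff Z P (W d)\<bar>"
    using assms(3) by (auto simp: min_def)
  then show "real (t d) * \<bar>r d - zone_tariff Z (cut_price M P) (W d)\<bar>
      \<le> real (t d) * \<bar>r d - zone_tariff Z P (W d)\<bar>"
    unfolding zone_tariff_cut_price[OF assms(1,2)] by (rule mult_left_mono) simp
qed

lemma zd_attained_fixed_partition:
  assumes "finite D" "zd_ma_feasible V E ne ns N Z P\<^sub>0"
  shows "\<exists>P. zd_ma_feasible V E ne ns N Z P \<and>
    (\<forall>P'. zd_ma_feasible V E ne ns N Z P' \<longrightarrow>
       zd_objective D r t W Z P \<le> zd_objective D r t W Z P')"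
proof -
  define M where "M = Max (insert 0 (r ` D))"
  have M: "0 \<le> M" "\<forall>d\<in>D. r d \<le> M"
    using assms(1) by (auto simp: M_def)
  define S where "S = {P. (\<forall>k. P k \<in> {0..M}) \<and>
    (ne \<longrightarrow> no_elongation V E (zone_tariff Z P)) \<and> (ns \<longrightarrow> no_stopover V E (zone_tariff Z P))}"
  have "S = {P. \<forall>k. P k \<in> {0..M}} \<inter>
    (if ne then {P. no_elongation V E (zone_tariff Z P)} else UNIV) \<inter>
    (if ns then {P. no_stopover V E (zone_tariff Z P)} else UNIV)"
    by (auto simp: S_def)
  then have "compact S"
    using compact_box[of M] closed_no_elongation[of V E Z] closed_no_stopover[of V E Z]
    by (auto intro!: compact_Int_closed)
  have cut: "cut_price M P \<in> S" if "zd_ma_feasible V E ne ns N Z P" for P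
    using zd_ma_feasible_cut_price[OF that M(1)] M(1)
    by (auto simp: S_def zd_ma_feasible_def cut_price_def)
  have feas: "zd_ma_feasible V E ne ns N Z P" if "P \<in> S" for P
    using that assms(2) by (auto simp: S_def zd_ma_feasible_def price_function_def)
  from cut[OF assms(2)] have "S \<noteq> {}" by blast
  with \<open>compact S\<close> obtain P where P: "P \<in> S"
    "\<forall>P'\<in>S. zd_objective D r t W Z P \<le> zd_objective D r t W Z P'"
    using continuous_attains_inf[OF _ _ continuous_on_zd_objective] by blast
  have "zd_objective D r t W Z P \<le> zd_objective D r t W Z P'"
    if f: "zd_ma_feasible V E ne ns N Z P'" for P'
  proof -
    have "zd_objective D r t W Z P \<le> zd_objective D r t W Z (cut_price M P')"
      using P(2) cut[OF f] by blast
    also have "\<dots> \<le> zd_objective D r t W Z P'"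
      using f M by (intro zd_objective_cut_price) (auto simp: zd_ma_feasible_def)
    finally show ?thesis .
  qed
  with feas[OF P(1)] show ?thesis by blast
qed

lemma zd_attained:
  assumes "finite V" "finite D" "Q Z\<^sub>0" "zd_ma_feasible V E ne ns N Z\<^sub>0 P\<^sub>0"
  shows "\<exists>Z P. (zd_ma_feasible V E ne ns N Z P \<and> Q Z) \<and>
    (\<forall>Z' P'. zd_ma_feasible V E ne ns N Z' P' \<and> Q Z' \<longrightarrow>
       zd_objective D r t W Z P \<le> zd_objective D r t W Z' P')"
proof -
  let ?F = "zd_ma_feasible V E ne ns N" and ?o = "zd_objective D r t W"
  define \<Z> where "\<Z> = {Z. Q Z \<and> (\<exists>P. ?F Z P)}"
  have fin: "finite \<Z>"
    by (rule finite_subset[OF _ finitely_many_partition_on[OF assms(1)]])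
      (auto simp: \<Z>_def zd_ma_feasible_def)
  have ne: "\<Z> \<noteq> {}"
    using assms(3,4) by (auto simp: \<Z>_def)
  have "\<exists>P. ?F Z P \<and> (\<forall>P'. ?F Z P' \<longrightarrow> ?o Z P \<le> ?o Z P')" if "Z \<in> \<Z>" for Z
    using that zd_attained_fixed_partition[OF assms(2)] unfolding \<Z>_def by blast
  then obtain p where p: "\<And>Z. Z \<in> \<Z> \<Longrightarrow> ?F Z (p Z) \<and> (\<forall>P'. ?F Z P' \<longrightarrow> ?o Z (p Z) \<le> ?o Z P')"
    by metis
  obtain Z where Z: "Z \<in> \<Z>" "\<And>Z'. Z' \<in> \<Z> \<Longrightarrow> ?o Z (p Z) \<le> ?o Z' (p Z')"
    using arg_min_if_finite(1)[OF fin ne, of "\<lambda>Z. ?o Z (p Z)"]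
      arg_min_least[OF fin ne, of _ "\<lambda>Z. ?o Z (p Z)"] by blast
  have "?o Z (p Z) \<le> ?o Z' P'" if "?F Z' P' \<and> Q Z'" for Z' P'
  proof -
    from that have "Z' \<in> \<Z>" by (auto simp: \<Z>_def)
    with Z(2) p that show ?thesis by (meson order_trans)
  qed
  moreover have "?F Z (p Z)" "Q Z"
    using p[OF Z(1)] Z(1) by (auto simp: \<Z>_def)
  ultimately show ?thesis by blast
qed

lemma zd_single_zone_feasible:
  assumes "zd_instance V E D r t W N"
  shows "zd_mc_feasible V E ne ns N {V} (\<lambda>_. 0)"
proof -
  from assms have V: "V \<noteq> {}" and c: "connected_graph V E" and N: "1 \<le> N"
    and s: "simple_graph V E"
    by (auto simp: zd_instance_def ptn_def connected_graph_def)
  have "induced_edges E V = E"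
    using s by (auto simp: induced_edges_def simple_graph_def)
  then show ?thesis
    using V c N
    by (auto simp: zd_mc_feasible_def zd_ma_feasible_def price_function_def no_elongation_def
        no_stopover_def zone_tariff_def partition_on_def disjoint_def)
qed

lemma zd_instance_finite:
  assumes "zd_instance V E D r t W N"
  shows "finite V" "finite D"
proof -
  show V: "finite V"
    using assms by (auto simp: zd_instance_def ptn_def simple_graph_def)
  show "finite D"
    by (rule finite_subset[of _ "V \<times> V"]) (use assms V in \<open>auto simp: zd_instance_def\<close>)
qed

lemma zd_ma_opt_attained:
  assumes "zd_instance V E D r t W N"
  shows "\<exists>Z P. zd_ma_feasible V E ne ns N Z P \<and>
    zd_objective D r t W Z P = zd_ma_opt V E D r t W ne ns N \<and>
    (\<forall>Z' P'. zd_ma_feasible V E ne ns N Z' P' \<longrightarrow>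
       zd_ma_opt V E D r t W ne ns N \<le> zd_objective D r t W Z' P')"
proof -
  have f: "zd_ma_feasible V E ne ns N {V} (\<lambda>_. 0)"
    using zd_single_zone_feasible[OF assms] by (simp add: zd_mc_feasible_def)
  obtain Z P where ZP: "zd_ma_feasible V E ne ns N Z P"
    "\<And>Z' P'. zd_ma_feasible V E ne ns N Z' P' \<Longrightarrow>
       zd_objective D r t W Z P \<le> zd_objective D r t W Z' P'"
    using zd_attained[OF zd_instance_finite[OF assms], of "\<lambda>_. True", OF _ f] by blast
  then have "zd_ma_opt V E D r t W ne ns N = zd_objective D r t W Z P"
    unfolding zd_ma_opt_def by (intro cInf_eq_minimum) auto
  with ZP show ?thesis by metis
qed

lemma zd_mc_opt_attained:
  assumes "zd_instance V E D r t W N"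
  shows "\<exists>Z P. zd_mc_feasible V E ne ns N Z P \<and>
    zd_objective D r t W Z P = zd_mc_opt V E D r t W ne ns N \<and>
    (\<forall>Z' P'. zd_mc_feasible V E ne ns N Z' P' \<longrightarrow>
       zd_mc_opt V E D r t W ne ns N \<le> zd_objective D r t W Z' P')"
proof -
  let ?Q = "\<lambda>Z. \<forall>z\<in>Z. connected_graph z (induced_edges E z)"
  have f: "zd_ma_feasible V E ne ns N {V} (\<lambda>_. 0)" "?Q {V}"
    using zd_single_zone_feasible[OF assms, of ne ns] unfolding zd_mc_feasible_def by blast+
  have "\<exists>Z P. zd_mc_feasible V E ne ns N Z P \<and>
    (\<forall>Z' P'. zd_mc_feasible V E ne ns N Z' P' \<longrightarrow>
       zd_objective D r t W Z P \<le> zd_objective D r t W Z' P')"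
    unfolding zd_mc_feasible_def
    by (rule zd_attained[where Q = ?Q, OF zd_instance_finite[OF assms] f(2,1)])
  then obtain Z P where ZP: "zd_mc_feasible V E ne ns N Z P"
    "\<And>Z' P'. zd_mc_feasible V E ne ns N Z' P' \<Longrightarrow>
       zd_objective D r t W Z P \<le> zd_objective D r t W Z' P'"
    by metis
  then have "zd_mc_opt V E D r t W ne ns N = zd_objective D r t W Z P"
    unfolding zd_mc_opt_def by (intro cInf_eq_minimum) auto
  with ZP show ?thesis by metis
qed

end

theory Submission
  imports Defs
begin

text \<open>
  Replace every zone by the connected components of the subgraph that it induces. An edge of the
  network with both endpoints in one zone connects these endpoints inside the zone, so they stay
  together in one component; conversely every component lies inside a zone. Hence the refined
  partition has exactly the same border edges (\<open>border_zone_components\<close>). Since the zone count of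
  a path with multiple counting depends on nothing but the border edges on it, the tariffs of the
  two partitions with the same price function coincide on all paths
  (\<open>zone_tariff_zone_components\<close>), and with them the no-elongation property, the no-stopover
  property and the objective value. There are at most \<open>card V\<close> components because each is
  non-empty.

  For \<open>N = card V\<close>, refining an optimal solution with arbitrary zones thus gives a solution with
  connected zones within the same bound and at the same cost, and connected zones are a special
  case of arbitrary ones.
\<close>

definition inner_arcs :: "'a set set \<Rightarrow> 'a set set \<Rightarrow> ('a \<times> 'a) set" where
  "inner_arcs E Z = {(u, v). {u, v} \<in> E \<and> (\<exists>z\<in>Z. {u, v} \<subseteq> z)}"

text \<open>
  All zones are split at once: the arcs inside zones never leave a zone, so the classes of
  reachability along them are the connected components of the induced subgraphs \<open>G[z]\<close>.
\<close>

definition zone_components :: "'a set \<Rightarrow> 'a set set \<Rightarrow> 'a set set \<Rightarrow> 'a set set" where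
  "zone_components V E Z = V // ((inner_arcs E Z)\<^sup>* \<inter> V \<times> V)"

lemma equiv_inner_reachability: "equiv V ((inner_arcs E Z)\<^sup>* \<inter> V \<times> V)"
proof -
  have "sym ((inner_arcs E Z)\<^sup>*)"
    by (intro sym_rtrancl symI) (auto simp: inner_arcs_def insert_commute)
  then show ?thesis
    by (auto intro!: equivI refl_onI symI transI dest: symD)
qed

lemma partition_on_zone_components: "partition_on V (zone_components V E Z)"
  unfolding zone_components_def by (rule partition_on_quotient[OF equiv_inner_reachability])

lemma card_zone_components_le: "finite V \<Longrightarrow> card (zone_components V E Z) \<le> card V"
  unfolding zone_components_def quotient_def by (simp add: UNION_singleton_eq_range card_image_le)

lemma zone_component_arc_closed:
  assumes "C \<in> zone_components V E Z" "partition_on V Z" "x \<in> C" "(x, y) \<in> inner_arcs E Z"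
  shows "y \<in> C"
proof -
  from assms(2,4) have "y \<in> V"
    by (auto simp: inner_arcs_def partition_on_def)
  with assms(1,3,4) show ?thesis
    by (auto simp: zone_components_def quotient_def intro: rtrancl_into_rtrancl)
qed

lemma zone_component_reachable:
  assumes "C \<in> zone_components V E Z" "x \<in> C" "y \<in> C"
  shows "(x, y) \<in> (inner_arcs E Z)\<^sup>*"
  using quotient_eq_iff[OF equiv_inner_reachability, of C V E Z C x y] assms
  by (auto simp: zone_components_def)

text \<open>
  Zones are pairwise disjoint, so two consecutive arcs inside zones lie in the same zone.
\<close>

lemma inner_reachable_same_zone:
  assumes "partition_on V Z" "(x, y) \<in> (inner_arcs E Z)\<^sup>*" "z \<in> Z" "x \<in> z"
  shows "y \<in> z"
  using assms(2,4)
proof (induction rule: rtrancl_induct)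
  case (step u v)
  then have "u \<in> z" by simp
  from step.hyps(2) obtain z' where z': "z' \<in> Z" "u \<in> z'" "v \<in> z'"
    by (auto simp: inner_arcs_def)
  with \<open>u \<in> z\<close> assms(1,3) have "z' = z"
    by (auto simp: partition_on_def disjoint_def)
  with z' show ?case by simp
qed

text \<open>
  Two adjacent nodes of one zone are in one component because the edge between them is itself an
  arc inside that zone. This fails for non-adjacent nodes, hence the restriction to edges.
\<close>

lemma border_zone_components:
  assumes "simple_graph V E" "partition_on V Z" "e \<in> E"
  shows "border (zone_components V E Z) e = border Z e"
proof -
  from assms(1,3) obtain u v where e: "e = {u, v}" and uv: "u \<in> V" "v \<in> V"
    by (auto simp: simple_graph_def)
  have "(\<exists>C\<in>zone_components V E Z. e \<subseteq> C) \<longleftrightarrow> (\<exists>z\<in>Z. e \<subseteq> z)"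
  proof
    assume "\<exists>C\<in>zone_components V E Z. e \<subseteq> C"
    then have "(u, v) \<in> (inner_arcs E Z)\<^sup>*"
      using zone_component_reachable by (auto simp: e)
    moreover from assms(2) uv(1) obtain z where "z \<in> Z" "u \<in> z"
      by (auto simp: partition_on_def)
    ultimately show "\<exists>z\<in>Z. e \<subseteq> z"
      using inner_reachable_same_zone[OF assms(2)] by (auto simp: e)
  next
    assume "\<exists>z\<in>Z. e \<subseteq> z"
    with assms(3) have arc: "(u, v) \<in> inner_arcs E Z"
      by (auto simp: inner_arcs_def e)
    from uv(1) obtain C where C: "C \<in> zone_components V E Z" "u \<in> C"
      using partition_on_zone_components[of V E Z] by (auto simp: partition_on_def)
    then show "\<exists>C\<in>zone_components V E Z. e \<subseteq> C"
      using zone_component_arc_closed[OF C(1) assms(2) C(2) arc] by (auto simp: e)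
  qed
  then show ?thesis by (simp add: border_def)
qed

lemma path_edges_subset: "ptn_path V E p \<Longrightarrow> path_edges p \<subseteq> E"
  by (auto simp: ptn_path_def path_edges_def successively_conv_nth)

lemma zone_tariff_zone_components:
  assumes "simple_graph V E" "partition_on V Z" "ptn_path V E p"
  shows "zone_tariff (zone_components V E Z) P p = zone_tariff Z P p"
proof -
  have "(\<Sum>e\<in>path_edges p. border (zone_components V E Z) e) = (\<Sum>e\<in>path_edges p. border Z e)"
    using path_edges_subset[OF assms(3)] border_zone_components[OF assms(1,2)]
    by (intro sum.cong) auto
  then show ?thesis by (simp add: zone_tariff_def zone_count_def)
qed

lemma ptn_path_of_arcs:
  assumes "(x, y) \<in> A\<^sup>*" "x \<in> C"
    and arcs: "\<And>u v. u \<in> C \<Longrightarrow> (u, v) \<in> A \<Longrightarrow> v \<in> C \<and> {u, v} \<in> F"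
  shows "\<exists>p. ptn_path C F p \<and> hd p = x \<and> last p = y"
  using assms(1)
proof (induction rule: rtrancl_induct)
  case base
  from \<open>x \<in> C\<close> show ?case by (intro exI[of _ "[x]"]) (simp add: ptn_path_def)
next
  case (step u v)
  then obtain p where p: "ptn_path C F p" "hd p = x" "last p = u" by blast
  then have "u \<in> C" by (auto simp: ptn_path_def)
  with arcs step.hyps(2) have "v \<in> C" "{u, v} \<in> F" by blast+
  with p show ?case
    by (intro exI[of _ "p @ [v]"]) (auto simp: ptn_path_def successively_append_iff)
qed

text \<open>
  A walk along arcs inside zones that starts in a component never leaves it, so all its edges are
  edges of the subgraph induced by that component.
\<close>

lemma connected_zone_components:
  assumes "partition_on V Z" "C \<in> zone_components V E Z"
  shows "connected_graph C (induced_edges E C)"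
  unfolding connected_graph_def
proof (intro conjI ballI)
  show "C \<noteq> {}"
    using partition_on_zone_components[of V E Z] assms(2) by (auto simp: partition_on_def)
next
  fix x y assume xy: "x \<in> C" "y \<in> C"
  show "\<exists>p. ptn_path C (induced_edges E C) p \<and> hd p = x \<and> last p = y"
  proof (rule ptn_path_of_arcs[OF zone_component_reachable[OF assms(2) xy] xy(1)])
    fix u v assume uv: "u \<in> C" "(u, v) \<in> inner_arcs E Z"
    with zone_component_arc_closed[OF assms(2,1)] show "v \<in> C \<and> {u, v} \<in> induced_edges E C"
      by (auto simp: induced_edges_def inner_arcs_def)
  qed
qed

lemma ptn_path_take: "ptn_path V E p \<Longrightarrow> 0 < i \<Longrightarrow> ptn_path V E (take i p)"
  by (auto simp: ptn_path_def successively_conv_nth dest: in_set_takeD)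

lemma ptn_path_drop: "ptn_path V E p \<Longrightarrow> i < length p \<Longrightarrow> ptn_path V E (drop i p)"
  by (auto simp: ptn_path_def successively_conv_nth dest: in_set_dropD)

text \<open>
  Both properties compare fares of paths of the network with fares of segments of these, which are
  again such paths. Two fare structures that agree on all paths are therefore indistinguishable,
  whatever their values on other node lists.
\<close>

lemma no_elongation_cong:
  assumes "\<And>p. ptn_path V E p \<Longrightarrow> \<pi> p = \<rho> p"
  shows "no_elongation V E \<pi> \<longleftrightarrow> no_elongation V E \<rho>"
proof -
  have "\<pi> p = \<rho> p \<and> \<pi> (butlast p) = \<rho> (butlast p)" if "ptn_path V E p \<and> 2 \<le> length p" for p
    using that assms ptn_path_take[of V E p "length p - 1"] by (simp add: butlast_conv_take)
  then show ?thesis by (auto simp: no_elongation_def)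
qed

lemma no_stopover_cong:
  assumes "\<And>p. ptn_path V E p \<Longrightarrow> \<pi> p = \<rho> p"
  shows "no_stopover V E \<pi> \<longleftrightarrow> no_stopover V E \<rho>"
proof -
  have "\<pi> p = \<rho> p \<and> \<pi> (take i p) = \<rho> (take i p) \<and> \<pi> (drop (i - 1) p) = \<rho> (drop (i - 1) p)"
    if "ptn_path V E p \<and> 3 \<le> length p" "i \<in> {2..length p - 1}" for p i
    using that assms ptn_path_take[of V E p i] ptn_path_drop[of V E p "i - 1"] by auto
  then show ?thesis unfolding no_stopover_def by (metis (no_types, lifting))
qed

lemma zd_mc_feasible_zone_components:
  assumes "simple_graph V E" "zd_ma_feasible V E ne ns N Z P"
  shows "zd_mc_feasible V E ne ns (card V) (zone_components V E Z) P"
proof -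
  from assms(2) have Z: "partition_on V Z" by (simp add: zd_ma_feasible_def)
  note eq = zone_tariff_zone_components[OF assms(1) Z]
  from assms(1) have "finite V" by (simp add: simple_graph_def)
  then show ?thesis
    using assms(2) partition_on_zone_components card_zone_components_le
      connected_zone_components[OF Z]
      no_elongation_cong[of V E "zone_tariff (zone_components V E Z) P", OF eq]
      no_stopover_cong[of V E "zone_tariff (zone_components V E Z) P", OF eq]
    by (auto simp: zd_mc_feasible_def zd_ma_feasible_def)
qed

lemma zd_objective_zone_components:
  assumes "simple_graph V E" "partition_on V Z" "\<And>d. d \<in> D \<Longrightarrow> ptn_path V E (W d)"
  shows "zd_objective D r t W (zone_components V E Z) P = zd_objective D r t W Z P"
  unfolding zd_objective_def
  by (intro sum.cong) (simp_all add: assms zone_tariff_zone_components)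

theorem theorem19:
  fixes V :: "'a set" and E :: "'a set set" and D :: "('a \<times> 'a) set"
    and r :: "'a \<times> 'a \<Rightarrow> real" and t :: "'a \<times> 'a \<Rightarrow> nat" and W :: "'a \<times> 'a \<Rightarrow> 'a list"
    and N :: nat and ne ns :: bool
  assumes "zd_instance V E D r t W N"
  shows "(\<forall>Z P. zd_ma_feasible V E ne ns N Z P \<longrightarrow>
            (\<exists>N' Z'. 1 \<le> N' \<and> N' \<le> card V \<and> zd_mc_feasible V E ne ns N' Z' P \<and>
               zd_objective D r t W Z' P = zd_objective D r t W Z P)) \<and>
         (N = card V \<longrightarrow>
            zd_ma_opt V E D r t W ne ns N = zd_mc_opt V E D r t W ne ns N)"
proof -
  from assms have G: "simple_graph V E" and "V \<noteq> {}"
    and W: "\<And>d. d \<in> D \<Longrightarrow> ptn_path V E (W d)"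
    by (auto simp: zd_instance_def ptn_def connected_graph_def)
  with zd_instance_finite(1)[OF assms] have V: "1 \<le> card V"
    by (simp add: Suc_le_eq card_gt_0_iff)
  have refine: "zd_mc_feasible V E ne ns (card V) (zone_components V E Z) P"
      "zd_objective D r t W (zone_components V E Z) P = zd_objective D r t W Z P"
    if "zd_ma_feasible V E ne ns N Z P" for Z P
    using that zd_mc_feasible_zone_components[OF G that] zd_objective_zone_components[OF G _ W]
    by (auto simp: zd_ma_feasible_def)
  have "zd_ma_opt V E D r t W ne ns N = zd_mc_opt V E D r t W ne ns N" if N: "N = card V"
  proof (rule antisym)
    obtain Z P where "zd_mc_feasible V E ne ns N Z P"
      "zd_objective D r t W Z P = zd_mc_opt V E D r t W ne ns N"
      using zd_mc_opt_attained[OF assms] by metis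
    then show "zd_ma_opt V E D r t W ne ns N \<le> zd_mc_opt V E D r t W ne ns N"
      using zd_ma_opt_attained[OF assms] by (metis zd_mc_feasible_def)
  next
    obtain Z P where "zd_ma_feasible V E ne ns N Z P"
      "zd_objective D r t W Z P = zd_ma_opt V E D r t W ne ns N"
      using zd_ma_opt_attained[OF assms] by metis
    then show "zd_mc_opt V E D r t W ne ns N \<le> zd_ma_opt V E D r t W ne ns N"
      using zd_mc_opt_attained[OF assms] refine N by metis
  qed
  with V refine show ?thesis by blast
qed

end
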